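(* Let $D$ be a discrete differential operator on the mesh with coefficients that sum to zero, and let $CD$ be the associated discrete covariant derivative (both as defined in the context). Let $d$ be the dimensionality of the manifold. Then for any rank $n$ tensor $w$ on the mesh (with curved components $w^{l_1 l_2\dots l_n}$ and Cartesian components $\tilde w^{j_1 j_2\dots j_n}$), any coordinate direction $s\in\{1,\dots,d\}$ and any mesh index $c$ at which the operators are evaluated, $$D_s\tilde{w}^{j_1j_2\dots j_n}_{,c} = 0 \quad \text{for all } (j_1,j_2,\dots,j_n)\in\{1,2,\dots,d\}^n$$ if and only if $$CD_s w^{l_1l_2\dots l_n}_{,c} = 0\quad\text{for all } (l_1,l_2,\dots,l_n)\in\{1,2,\dots,d\}^n.$$
   Context: Mesh and Jacobians. A $d$-dimensional manifold is described by Cartesian coordinates $\tilde x^1,\dots,\tilde x^d$ and curved coordinates $x^1,\dots,x^d$. It is represented discretely by a finite mesh of $N$ points, indexed by $k\in\{1,\dots,N\}$; a subscript after a comma denotes the mesh index at which a quantity is evaluated. At each mesh point $k$ there is given an invertible real $d\times d$ Jacobian matrix with entries $\left(\frac{\partial \tilde x^{j}}{\partial x^{l}}\right)_{,k}$ (row $j$, column $l$); $\left(\frac{\partial \tilde x^{l}}{\partial x^{m}}\right)^{-1}_{,k}$ denotes the $(l,m)$ entry of the inverse of this matrix. Repeated tensor indices are summed from $1$ to $d$. Tensors. A rank $n$ tensor $w$ on the mesh ($n\ge 1$) is an assignment to each mesh point $k$ of real components $w^{l_1\dots l_n}_{,k}$, $l_1,\dots,l_n\in\{1,\dots,d\}$,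 in the curved system. Its Cartesian components are $$\tilde w^{j_1\dots j_n}_{,k} = \left(\prod_{a=1}^n \left(\frac{\partial \tilde x^{j_a}}{\partial x^{l_a}}\right)_{,k}\right) w^{l_1\dots l_n}_{,k}.$$ Discrete differential operator. $D_s$ denotes a discrete differential operator for differentiation in the $s$-th curved coordinate direction $x^s$. At a mesh index $c$ it is a linear combination, with fixed real coefficients (depending only on $s$, $c$ and the mesh/stencil), of the values at mesh points of the function it acts on; it acts on tensor components componentwise. "Coefficients that sum to zero" means that, for each $s$ and $c$, these coefficients sum to zero. Consequently the operator can be written (not necessarily uniquely) as a weighted sum of differences $$D_s f_{,c} = \sum_{i} \phi_i\left(f_{,k_i^+} - f_{,k_i^-}\right),$$ a finite sum with real weights $\phi_i$ and mesh indices $k_i^+,k_i^-$ (depending on $s$ and $c$). Fix such a representation. Associated discrete covariant derivative. For a rank $n$ tensor $w$, the discrete covariant derivative associated with $D_s$ is defined at mesh index $c$ by $$\begin{aligned} CD_s w^{i_1\dots i_n}_{,c} = \sum_{i}\phi_i\Bigg[&\left(w^{i_1\dots i_n}_{,k_i^+}-w^{i_1\dots i_n}_{,k_i^-}\right)\\ &+\prod_{a=1}^n\left(\frac{\partial\tilde x^{i_a}}{\partial x^{j_a}}\right)^{-1}_{,c}\left(\prod_{a=1}^n\left(\frac{\partial\tilde x^{j_a}}{\partial x^{m_a}}\right)_{,k_i^+}-\prod_{a=1}^n\left(\frac{\partial\tilde x^{j_a}}{\partial x^{m_a}}\right)_{,c}\right)w^{m_1\dots m_n}_{,k_i^+}\\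 &+\prod_{a=1}^n\left(\frac{\partial\tilde x^{i_a}}{\partial x^{j_a}}\right)^{-1}_{,c}\left(\prod_{a=1}^n\left(\frac{\partial\tilde x^{j_a}}{\partial x^{m_a}}\right)_{,c}-\prod_{a=1}^n\left(\frac{\partial\tilde x^{j_a}}{\partial x^{m_a}}\right)_{,k_i^-}\right)w^{m_1\dots m_n}_{,k_i^-}\Bigg], \end{aligned}$$ where the repeated indices $j_1,\dots,j_n$ and $m_1,\dots,m_n$ are each summed from $1$ to $d$. *)

theory Defs
  imports "HOL-Analysis.Analysis"
begin

text \<open>
  Encoding: the mesh points are the elements of a finite type \<open>'p\<close>, the coordinate directions
  \<open>1, \<dots>, d\<close> the elements of a finite type \<open>'d\<close>, and the index positions
  \<open>1, \<dots>, n\<close> of a rank \<open>n\<close> tensor the elements of a finite type \<open>'n\<close>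
  (types are nonempty, so \<open>n \<ge> 1\<close>).  A multi-index is an element of \<open>'d ^ 'n\<close>, and
  \<open>w k l\<close> is the component with multi-index \<open>l\<close> of the tensor \<open>w\<close> at the mesh point \<open>k\<close>.
\<close>

type_synonym ('p, 'd, 'n) tensor = "'p \<Rightarrow> 'd ^ 'n \<Rightarrow> real"

text \<open>
  Jacobians: \<open>J k $ j $ l\<close> is the derivative of the Cartesian coordinate \<open>j\<close> with respect to
  the curved coordinate \<open>l\<close>, at the mesh point \<open>k\<close>.
\<close>

type_synonym ('p, 'd) jacobians = "'p \<Rightarrow> real ^ 'd ^ 'd"

definition cartesian ::
  "('p, 'd::finite) jacobians \<Rightarrow> ('p, 'd, 'n::finite) tensor \<Rightarrow> ('p, 'd, 'n) tensor" where
  "cartesian J w k j = (\<Sum>l\<in>UNIV. (\<Prod>a\<in>UNIV. J k $ (j $ a) $ (l $ a)) * w k l)"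

text \<open>
  \<open>coef s c k\<close> is the coefficient of the value at \<open>k\<close> in the operator for direction \<open>s\<close>
  evaluated at \<open>c\<close>.
\<close>

definition discrete_diff ::
  "('d \<Rightarrow> 'p \<Rightarrow> 'p \<Rightarrow> real) \<Rightarrow> 'd \<Rightarrow> ('p::finite \<Rightarrow> real) \<Rightarrow> 'p \<Rightarrow> real" where
  "discrete_diff coef s f c = (\<Sum>k\<in>UNIV. coef s c k * f k)"

definition coeffs_sum_zero :: "('d \<Rightarrow> 'p::finite \<Rightarrow> 'p \<Rightarrow> real) \<Rightarrow> bool" where
  "coeffs_sum_zero coef \<longleftrightarrow> (\<forall>s c. (\<Sum>k\<in>UNIV. coef s c k) = 0)"

text \<open>
  A weighted sum of differences is given, for each direction and mesh point, by the list of its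
  terms: the triple \<open>(\<phi>, p, m)\<close> stands for \<open>\<phi> * (f p - f m)\<close>.
\<close>

type_synonym ('p, 'd) difference_form = "'d \<Rightarrow> 'p \<Rightarrow> (real \<times> 'p \<times> 'p) list"

definition represents ::
  "('p::finite, 'd) difference_form \<Rightarrow> ('d \<Rightarrow> 'p \<Rightarrow> 'p \<Rightarrow> real) \<Rightarrow> bool" where
  "represents R coef \<longleftrightarrow>
     (\<forall>s c f. discrete_diff coef s f c = (\<Sum>(\<phi>, p, m)\<leftarrow>R s c. \<phi> * (f p - f m)))"

definition covariant_diff ::
  "('p, 'd::finite) jacobians \<Rightarrow> ('p, 'd) difference_form \<Rightarrow> 'd \<Rightarrow>
   ('p, 'd, 'n::finite) tensor \<Rightarrow> ('p, 'd, 'n) tensor" where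
  "covariant_diff J R s w c i =
     (\<Sum>(\<phi>, kp, km)\<leftarrow>R s c. \<phi> * (
        (w kp i - w km i)
      + (\<Sum>j\<in>UNIV. \<Sum>m\<in>UNIV.
           (\<Prod>a\<in>UNIV. matrix_inv (J c) $ (i $ a) $ (j $ a)) *
           ((\<Prod>a\<in>UNIV. J kp $ (j $ a) $ (m $ a)) - (\<Prod>a\<in>UNIV. J c $ (j $ a) $ (m $ a))) *
           w kp m)
      + (\<Sum>j\<in>UNIV. \<Sum>m\<in>UNIV.
           (\<Prod>a\<in>UNIV. matrix_inv (J c) $ (i $ a) $ (j $ a)) *
           ((\<Prod>a\<in>UNIV. J c $ (j $ a) $ (m $ a)) - (\<Prod>a\<in>UNIV. J km $ (j $ a) $ (m $ a))) *
           w km m)))"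

end

theory Submission
  imports Defs
begin

text \<open>
  A \<open>d \<times> d\<close> matrix \<open>A\<close> acts on arrays of components by its \<open>n\<close>-th tensor power.  This
  action is linear on arrays, and it takes products of matrices to compositions
  (\<open>tensor_action_mult\<close>) and the identity matrix to the identity (\<open>tensor_action_mat_1\<close>), so
  an invertible matrix acts bijectively.  The Cartesian components at \<open>k\<close> are the action of
  \<open>J k\<close> on the curved ones, and the discrete covariant derivative at \<open>c\<close> is the action of the
  inverse of \<open>J c\<close> on the discrete derivatives of the Cartesian components
  (\<open>covariant_diff_eq_tensor_action_discrete_diff\<close>).  The point is that the
  two terms of \<open>covariant_diff\<close> that contain \<open>J c\<close> reproduce \<open>w kp\<close> and \<open>w km\<close> with
  the signs that cancel the plain difference of \<open>w\<close>.  Hence one family of derivatives is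
  obtained from the other by a linear bijection, and they vanish together.
\<close>

definition tensor_action ::
  "real ^ 'd ^ 'd \<Rightarrow> ('d::finite ^ 'n::finite \<Rightarrow> real) \<Rightarrow> 'd ^ 'n \<Rightarrow> real" where
  "tensor_action A v i = (\<Sum>l\<in>UNIV. (\<Prod>a\<in>UNIV. A $ (i $ a) $ (l $ a)) * v l)"

lemma cartesian_eq_tensor_action: "cartesian J w k = tensor_action (J k) (w k)"
  by (simp add: fun_eq_iff cartesian_def tensor_action_def)

lemma tensor_action_zero: "tensor_action A (\<lambda>_. 0) = (\<lambda>_. 0)"
  by (simp add: fun_eq_iff tensor_action_def)

lemma tensor_action_add:
  "tensor_action A (\<lambda>l. u l + v l) i = tensor_action A u i + tensor_action A v i"
  by (simp add: tensor_action_def distrib_left sum.distrib)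

lemma tensor_action_diff:
  "tensor_action A (\<lambda>l. u l - v l) i = tensor_action A u i - tensor_action A v i"
  by (simp add: tensor_action_def right_diff_distrib sum_subtractf)

lemma tensor_action_scale:
  "tensor_action A (\<lambda>l. r * v l) i = r * tensor_action A v i"
  by (simp add: tensor_action_def sum_distrib_left mult.left_commute)

lemma tensor_action_sum_list:
  "tensor_action A (\<lambda>l. \<Sum>x\<leftarrow>xs. f x l) i = (\<Sum>x\<leftarrow>xs. tensor_action A (f x) i)"
  by (induction xs) (simp_all add: tensor_action_zero tensor_action_add)

text \<open>
  The distributive law for a product of finite sums, with the choice functions in its
  expansion read as multi-indices.
\<close>
lemma prod_sum_vec:
  fixes f :: "'n::finite \<Rightarrow> 'd::finite \<Rightarrow> 'b::comm_semiring_1"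
  shows "(\<Prod>a\<in>UNIV. \<Sum>x\<in>UNIV. f a x) = (\<Sum>m\<in>UNIV. \<Prod>a\<in>UNIV. f a ((m :: 'd ^ 'n) $ a))"
proof -
  have "(\<Prod>a\<in>UNIV. \<Sum>x\<in>UNIV. f a x) = (\<Sum>g\<in>UNIV. \<Prod>a\<in>UNIV. f a (g a))"
    by (simp add: prod_sum_PiE)
  also have "\<dots> = (\<Sum>m\<in>UNIV. \<Prod>a\<in>UNIV. f a ((m :: 'd ^ 'n) $ a))"
    by (rule sum.reindex_bij_witness[where i = vec_nth and j = vec_lambda]) auto
  finally show ?thesis .
qed

lemma tensor_action_mult:
  "tensor_action A (tensor_action B v) = tensor_action (A ** B) v"
proof
  fix i
  have "tensor_action A (tensor_action B v) i =
      (\<Sum>l\<in>UNIV. (\<Sum>m\<in>UNIV. \<Prod>a\<in>UNIV. A $ (i $ a) $ (m $ a) * B $ (m $ a) $ (l $ a)) * v l)"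
    unfolding tensor_action_def sum_distrib_left sum_distrib_right
    by (subst sum.swap) (simp add: prod.distrib mult.assoc)
  also have "\<dots> = tensor_action (A ** B) v i"
    by (simp add: tensor_action_def matrix_matrix_mult_def
        prod_sum_vec[of "\<lambda>a x. A $ (i $ a) $ x * B $ x $ (l $ a)" for l])
  finally show "tensor_action A (tensor_action B v) i = tensor_action (A ** B) v i" .
qed

lemma tensor_action_mat_1:
  fixes v :: "'d::finite ^ 'n::finite \<Rightarrow> real"
  shows "tensor_action (mat 1) v = v"
proof
  fix i :: "'d ^ 'n"
  have "(\<Prod>a\<in>UNIV. mat 1 $ (i $ a) $ (l $ a) :: real) = (if l = i then 1 else 0)" for l :: "'d ^ 'n"
    by (auto simp: mat_def vec_eq_iff prod_zero_iff dest: sym)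
  then show "tensor_action (mat 1) v i = v i"
    by (simp add: tensor_action_def if_distrib[of "\<lambda>x. x * _"] cong: if_cong)
qed

lemma tensor_action_matrix_inv:
  assumes "invertible A"
  shows "tensor_action (matrix_inv A) (tensor_action A v) = v"
    and "tensor_action A (tensor_action (matrix_inv A) v) = v"
proof -
  have "A ** matrix_inv A = mat 1 \<and> matrix_inv A ** A = mat 1"
    using assms unfolding invertible_def matrix_inv_def by (rule someI_ex)
  then show "tensor_action (matrix_inv A) (tensor_action A v) = v"
    and "tensor_action A (tensor_action (matrix_inv A) v) = v"
    by (simp_all add: tensor_action_mult tensor_action_mat_1)
qed

lemma tensor_action_of_matrix_difference:
  "(\<Sum>j\<in>UNIV. \<Sum>m\<in>UNIV. (\<Prod>a\<in>UNIV. K $ (i $ a) $ (j $ a)) *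
      ((\<Prod>a\<in>UNIV. A $ (j $ a) $ (m $ a)) - (\<Prod>a\<in>UNIV. B $ (j $ a) $ (m $ a))) * v m) =
   tensor_action K (tensor_action A v) i - tensor_action K (tensor_action B v) i"
  by (simp add: tensor_action_def sum_distrib_left left_diff_distrib right_diff_distrib
      sum_subtractf mult.assoc)

text \<open>
  Acting with the inverse of \<open>J c\<close> on a difference of Cartesian components produces one bracket
  of the covariant derivative, because the inverse undoes the \<open>J c\<close> in the two
  correction terms.
\<close>
lemma covariant_diff_eq_tensor_action_discrete_diff:
  assumes "invertible (J c)" and "represents R coef"
  shows "covariant_diff J R s w c =
    tensor_action (matrix_inv (J c)) (\<lambda>j. discrete_diff coef s (\<lambda>k. cartesian J w k j) c)"
proof
  fix i
  let ?K = "matrix_inv (J c)"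
  have "covariant_diff J R s w c i =
      (\<Sum>(\<phi>, p, m)\<leftarrow>R s c. \<phi> * (tensor_action ?K (cartesian J w p) i -
                                 tensor_action ?K (cartesian J w m) i))"
    unfolding covariant_diff_def tensor_action_of_matrix_difference
    by (simp add: tensor_action_matrix_inv(1)[OF assms(1)] cartesian_eq_tensor_action)
  also have "\<dots> = tensor_action ?K
      (\<lambda>j. \<Sum>(\<phi>, p, m)\<leftarrow>R s c. \<phi> * (cartesian J w p j - cartesian J w m j)) i"
    by (simp add: tensor_action_sum_list case_prod_unfold tensor_action_scale tensor_action_diff)
  also have "\<dots> = tensor_action ?K
      (\<lambda>j. discrete_diff coef s (\<lambda>k. cartesian J w k j) c) i"
    using assms(2) by (simp add: represents_def)
  finally show "covariant_diff J R s w c i = \<dots>" .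
qed

theorem theorem3p2:
  fixes J :: "('p::finite, 'd::finite) jacobians"
    and coef :: "'d \<Rightarrow> 'p \<Rightarrow> 'p \<Rightarrow> real"
    and R :: "('p, 'd) difference_form"
    and w :: "('p, 'd, 'n::finite) tensor"
    and s :: 'd and c :: 'p
  assumes "\<And>k. invertible (J k)"
    and "coeffs_sum_zero coef"
    and "represents R coef"
  shows "(\<forall>j. discrete_diff coef s (\<lambda>k. cartesian J w k j) c = 0) \<longleftrightarrow>
         (\<forall>l. covariant_diff J R s w c l = 0)"
proof -
  let ?D = "\<lambda>j. discrete_diff coef s (\<lambda>k. cartesian J w k j) c"
  have CD: "covariant_diff J R s w c = tensor_action (matrix_inv (J c)) ?D"
    using assms(1,3) by (rule covariant_diff_eq_tensor_action_discrete_diff)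
  then have D: "?D = tensor_action (J c) (covariant_diff J R s w c)"
    by (simp add: tensor_action_matrix_inv(2)[OF assms(1)])
  have "?D = (\<lambda>_. 0) \<longleftrightarrow> covariant_diff J R s w c = (\<lambda>_. 0)"
    using CD D tensor_action_zero by metis
  then show ?thesis
    by (simp add: fun_eq_iff)
qed

end
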